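(* Let $\mathcal{M}=\langle\Sigma,\mu,v^+,v^-\rangle$ be a probabilistic model and let $p_\mu:\mathcal{L}\to\mathbb{R}$ and $\hat p_\mu:\mathcal{L}\to\mathbb{R}^4$ be its induced non-standard and four-valued probability functions. Then $tr_{ns}^4(\hat p_\mu)=p_\mu$ and $tr_4^{ns}(p_\mu)=\hat p_\mu$.
   Context: Let $\mathrm{Prop}$ be a fixed finite set of propositional variables and let $\mathcal{L}$ be the set of formulas generated by $\varphi::= p\mid\neg\varphi\mid\varphi\wedge\varphi$ with $p\in\mathrm{Prop}$; $\varphi\vee\psi$ abbreviates $\neg(\neg\varphi\wedge\neg\psi)$. A probabilistic model is a tuple $\mathcal{M}=\langle\Sigma,\mu,v^+,v^-\rangle$ where $\Sigma$ is a finite or countably infinite set, $v^+,v^-:\Sigma\times\mathrm{Prop}\to\{0,1\}$ are arbitrary functions, and $\mu$ is a (classical) probability measure on the full power set of $\Sigma$. Define relations $\models^+,\models^-$ between states $s\in\Sigma$ and formulas by: $s\models^+p$ iff $v^+(s,p)=1$; $s\models^-p$ iff $v^-(s,p)=1$; $s\models^+\varphi\wedge\psi$ iff $s\models^+\varphi$ and $s\models^+\psi$; $s\models^-\varphi\wedge\psi$ iff $s\models^-\varphi$ or $s\models^-\psi$; $s\models^+\neg\varphi$ iff $s\models^-\varphi$; $s\models^-\neg\varphi$ iff $s\models^+\varphi$. Put $|\varphi|^{+}=\{s: s\models^{+}\varphi\}$, $|\varphi|^{-}=\{s: s\models^{-}\varphi\}$, $|\varphi|^b=|\varphi|^+\setminus|\varphi|^-$,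 $|\varphi|^d=|\varphi|^-\setminus|\varphi|^+$, $|\varphi|^c=|\varphi|^+\cap|\varphi|^-$, $|\varphi|^u=\Sigma\setminus(|\varphi|^+\cup|\varphi|^-)$. The induced non-standard probability function is $p_\mu(\varphi)=\mu(|\varphi|^+)$; the induced four-valued probability function is $\hat p_\mu(\varphi)=(\mu(|\varphi|^b),\mu(|\varphi|^d),\mu(|\varphi|^u),\mu(|\varphi|^c))$. Translation maps: for $\hat p:\mathcal{L}\to\mathbb{R}^4$ with $\hat p(\varphi)=(b_\varphi,d_\varphi,u_\varphi,c_\varphi)$, $tr_{ns}^4(\hat p)(\varphi)=b_\varphi+c_\varphi$. For $p:\mathcal{L}\to\mathbb{R}$, $tr_4^{ns}(p)(\varphi)=(p(\varphi)-p(\varphi\wedge\neg\varphi),\;p(\neg\varphi)-p(\varphi\wedge\neg\varphi),\;1-p(\varphi)-p(\neg\varphi)+p(\varphi\wedge\neg\varphi),\;p(\varphi\wedge\neg\varphi))$. *)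

theory Defs
  imports "HOL-Probability.Probability"
begin

datatype 'p form =
    Atom 'p
  | Neg "'p form"
  | Conj "'p form" "'p form"  (infixr "\<^bold>\<and>" 35)

notation Neg ("\<^bold>\<not> _" [40] 40)

text \<open>
  The set of states is the space of the measure. The two valuations have codomain
  \<open>{0,1}\<close>, rendered as \<^typ>\<open>bool\<close>; their values outside the set of states are irrelevant,
  because all extensions below are intersected with it.
\<close>

record ('s, 'p) model =
  prob_meas :: "'s measure"
  val_pos :: "'s \<Rightarrow> 'p \<Rightarrow> bool"
  val_neg :: "'s \<Rightarrow> 'p \<Rightarrow> bool"

definition states :: "('s, 'p) model \<Rightarrow> 's set" where
  "states \<M> = space (prob_meas \<M>)"

definition probabilistic_model :: "('s, 'p) model \<Rightarrow> bool" where
  "probabilistic_model \<M> \<longleftrightarrow>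
     countable (states \<M>) \<and>
     sets (prob_meas \<M>) = Pow (states \<M>) \<and>
     prob_space (prob_meas \<M>)"

fun sat_pos :: "('s, 'p) model \<Rightarrow> 's \<Rightarrow> 'p form \<Rightarrow> bool"
  and sat_neg :: "('s, 'p) model \<Rightarrow> 's \<Rightarrow> 'p form \<Rightarrow> bool" where
  "sat_pos \<M> s (Atom p) \<longleftrightarrow> val_pos \<M> s p"
| "sat_pos \<M> s (\<^bold>\<not> \<phi>) \<longleftrightarrow> sat_neg \<M> s \<phi>"
| "sat_pos \<M> s (\<phi> \<^bold>\<and> \<psi>) \<longleftrightarrow> sat_pos \<M> s \<phi> \<and> sat_pos \<M> s \<psi>"
| "sat_neg \<M> s (Atom p) \<longleftrightarrow> val_neg \<M> s p"
| "sat_neg \<M> s (\<^bold>\<not> \<phi>) \<longleftrightarrow> sat_pos \<M> s \<phi>"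
| "sat_neg \<M> s (\<phi> \<^bold>\<and> \<psi>) \<longleftrightarrow> sat_neg \<M> s \<phi> \<or> sat_neg \<M> s \<psi>"

definition ext_pos :: "('s, 'p) model \<Rightarrow> 'p form \<Rightarrow> 's set" where
  "ext_pos \<M> \<phi> = {s \<in> states \<M>. sat_pos \<M> s \<phi>}"

definition ext_neg :: "('s, 'p) model \<Rightarrow> 'p form \<Rightarrow> 's set" where
  "ext_neg \<M> \<phi> = {s \<in> states \<M>. sat_neg \<M> s \<phi>}"

text \<open>Pure belief, pure disbelief, uncertainty and conflict.\<close>

definition ext_b :: "('s, 'p) model \<Rightarrow> 'p form \<Rightarrow> 's set" where
  "ext_b \<M> \<phi> = ext_pos \<M> \<phi> - ext_neg \<M> \<phi>"

definition ext_d :: "('s, 'p) model \<Rightarrow> 'p form \<Rightarrow> 's set" where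
  "ext_d \<M> \<phi> = ext_neg \<M> \<phi> - ext_pos \<M> \<phi>"

definition ext_u :: "('s, 'p) model \<Rightarrow> 'p form \<Rightarrow> 's set" where
  "ext_u \<M> \<phi> = states \<M> - (ext_pos \<M> \<phi> \<union> ext_neg \<M> \<phi>)"

definition ext_c :: "('s, 'p) model \<Rightarrow> 'p form \<Rightarrow> 's set" where
  "ext_c \<M> \<phi> = ext_pos \<M> \<phi> \<inter> ext_neg \<M> \<phi>"

definition ns_prob :: "('s, 'p) model \<Rightarrow> 'p form \<Rightarrow> real" where
  "ns_prob \<M> \<phi> = measure (prob_meas \<M>) (ext_pos \<M> \<phi>)"

text \<open>Components are listed in the order \<open>(b, d, u, c)\<close>.\<close>

definition four_prob :: "('s, 'p) model \<Rightarrow> 'p form \<Rightarrow> real \<times> real \<times> real \<times> real" where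
  "four_prob \<M> \<phi> =
     (measure (prob_meas \<M>) (ext_b \<M> \<phi>),
      measure (prob_meas \<M>) (ext_d \<M> \<phi>),
      measure (prob_meas \<M>) (ext_u \<M> \<phi>),
      measure (prob_meas \<M>) (ext_c \<M> \<phi>))"

definition tr_four_to_ns ::
  "('p form \<Rightarrow> real \<times> real \<times> real \<times> real) \<Rightarrow> 'p form \<Rightarrow> real" where
  "tr_four_to_ns q \<phi> = (case q \<phi> of (b, d, u, c) \<Rightarrow> b + c)"

definition tr_ns_to_four ::
  "('p form \<Rightarrow> real) \<Rightarrow> 'p form \<Rightarrow> real \<times> real \<times> real \<times> real" where
  "tr_ns_to_four p \<phi> =
     (p \<phi> - p (\<phi> \<^bold>\<and> \<^bold>\<not> \<phi>),
      p (\<^bold>\<not> \<phi>) - p (\<phi> \<^bold>\<and> \<^bold>\<not> \<phi>),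
      1 - p \<phi> - p (\<^bold>\<not> \<phi>) + p (\<phi> \<^bold>\<and> \<^bold>\<not> \<phi>),
      p (\<phi> \<^bold>\<and> \<^bold>\<not> \<phi>))"

end

theory Submission
  imports Defs
begin

text \<open>
  The non-standard function only measures positive extensions, but negation exchanges the
  positive and the negative extension, so \<open>p(\<not>\<phi>)\<close> is the measure of \<open>|\<phi>|\<^sup>-\<close>, and consequently
  \<open>p(\<phi> \<and> \<not>\<phi>)\<close> is the measure of the conflict set \<open>|\<phi>|\<^sup>+ \<inter> |\<phi>|\<^sup>-\<close>
  (\<open>ext_pos_Neg\<close>, \<open>ext_pos_contradiction\<close>). Thus both probability functions describe the same
  two events \<open>A = |\<phi>|\<^sup>+\<close> and \<open>B = |\<phi>|\<^sup>-\<close>: the four-valued one lists the measures of the four cells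
  into which \<open>A\<close> and \<open>B\<close> split the state space, the non-standard one gives the measures of \<open>A\<close>,
  \<open>B\<close> and \<open>A \<inter> B\<close>. The translations are the classical conversions between these data:
  additivity of the measure on \<open>A\<close>, and inclusion-exclusion for the complement of \<open>A \<union> B\<close>.
\<close>

lemma ext_pos_Neg: "ext_pos \<M> (\<^bold>\<not> \<phi>) = ext_neg \<M> \<phi>"
  by (simp add: ext_pos_def ext_neg_def)

lemma ext_pos_Conj: "ext_pos \<M> (\<phi> \<^bold>\<and> \<psi>) = ext_pos \<M> \<phi> \<inter> ext_pos \<M> \<psi>"
  by (auto simp: ext_pos_def)

text \<open>
  A contradiction holds exactly at the states with conflicting information; this is how the
  conflict set becomes visible to a function that only measures positive extensions.
\<close>

lemma ext_pos_contradiction: "ext_pos \<M> (\<phi> \<^bold>\<and> \<^bold>\<not> \<phi>) = ext_c \<M> \<phi>"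
  by (simp add: ext_pos_Conj ext_pos_Neg ext_c_def)

text \<open>
  Every subset of the state space of a probabilistic model is an event, so the laws of
  probability apply to all extensions.
\<close>

lemma ext_measurable:
  assumes "probabilistic_model \<M>"
  shows "ext_pos \<M> \<phi> \<in> sets (prob_meas \<M>)" and "ext_neg \<M> \<phi> \<in> sets (prob_meas \<M>)"
  using assms by (auto simp: probabilistic_model_def ext_pos_def ext_neg_def)

lemma (in prob_space) prob_compl_Un:
  assumes "A \<in> events" and "B \<in> events"
  shows "prob (space M - (A \<union> B)) = 1 - prob A - prob B + prob (A \<inter> B)"
proof -
  have "prob (A \<union> B) = prob A + prob B - prob (A \<inter> B)"
    using finite_measure_Union'[OF assms] finite_measure_Diff'[OF assms(2,1)]
    by (simp add: Int_commute)
  then show ?thesis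
    using prob_compl[of "A \<union> B"] assms by simp
qed

theorem theorem3:
  fixes \<M> :: "('s, 'p::finite) model"
  assumes "probabilistic_model \<M>"
  shows "tr_four_to_ns (four_prob \<M>) = ns_prob \<M> \<and>
         tr_ns_to_four (ns_prob \<M>) = four_prob \<M>"
proof -
  interpret prob_space "prob_meas \<M>"
    using assms by (simp add: probabilistic_model_def)
  note ev = ext_measurable[OF assms]
  have b: "prob (ext_b \<M> \<phi>) = prob (ext_pos \<M> \<phi>) - prob (ext_c \<M> \<phi>)" for \<phi>
    unfolding ext_b_def ext_c_def by (rule finite_measure_Diff'[OF ev])
  have d: "prob (ext_d \<M> \<phi>) = prob (ext_neg \<M> \<phi>) - prob (ext_c \<M> \<phi>)" for \<phi>
    unfolding ext_d_def ext_c_def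
    using finite_measure_Diff'[OF ev(2) ev(1)] by (simp add: Int_commute)
  have u: "prob (ext_u \<M> \<phi>)
      = 1 - prob (ext_pos \<M> \<phi>) - prob (ext_neg \<M> \<phi>) + prob (ext_c \<M> \<phi>)" for \<phi>
    unfolding ext_u_def ext_c_def states_def by (rule prob_compl_Un[OF ev])
  show ?thesis
  proof (intro conjI ext)
    show "tr_four_to_ns (four_prob \<M>) \<phi> = ns_prob \<M> \<phi>" for \<phi>
      by (simp add: tr_four_to_ns_def four_prob_def ns_prob_def b)
    show "tr_ns_to_four (ns_prob \<M>) \<phi> = four_prob \<M> \<phi>" for \<phi>
      by (simp add: tr_ns_to_four_def four_prob_def ns_prob_def ext_pos_contradiction
          ext_pos_Neg b d u)
  qed
qed

end
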